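(* Let $\alpha$ and $\gamma$ be any non-empty permutations, let $n$ be a positive integer, and let $\beta=\delta_n$ be the decreasing permutation of order $n$. Then $$\mathrm{Av}(\alpha\oplus\beta\oplus\gamma)\subseteq\bigl(\mathcal{V}(\mathrm{Av}(\alpha\oplus\beta),\mathrm{Av}(\beta\oplus\gamma))\cap\mathrm{Av}(\alpha\oplus\beta\oplus\gamma)\bigr)\circ\mathcal{H}.$$ In particular, $\mathrm{Av}(\alpha\oplus\delta_n\oplus\gamma)$ is $2$-composable whenever $\alpha\oplus\delta_n\oplus\gamma\notin\mathcal{H}$.
   Context: A permutation of order $n$ is a bijection $\pi:[n]\to[n]$, where $[n]=\{1,\dots,n\}$, also viewed as the sequence $\pi(1),\dots,\pi(n)$; the empty permutation (order $0$) is allowed. Two sequences of distinct numbers of the same length are order-isomorphic if their entries are in the same relative order. A permutation $\pi$ is contained in $\sigma$ if $\sigma$ has a (not necessarily contiguous) subsequence order-isomorphic to $\pi$; otherwise $\sigma$ avoids $\pi$. A permutation class is a set of permutations closed downwards under containment. $\mathrm{Av}(\pi)$ is the class of all permutations avoiding $\pi$. For permutations of the same order, $(\pi\circ\sigma)(i)=\pi(\sigma(i))$. For permutation classes, $\mathcal{A}\circ\mathcal{B}=\{\pi\circ\varphi : \pi\in\mathcal{A},\varphi\in\mathcal{B},|\pi|=|\varphi|\}$. A class $\mathcal{C}$ is $2$-composable if there are permutation classes $\mathcal{C}_1,\mathcal{C}_2\subsetneq\mathcal{C}$ with $\mathcal{C}\subseteq\mathcal{C}_1\circ\mathcal{C}_2$.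 The sum $\pi\oplus\sigma$ of $\pi$ of order $k$ and $\sigma$ of order $l$ is the permutation $\pi(1),\dots,\pi(k),\sigma(1)+k,\dots,\sigma(l)+k$. $\delta_n$ denotes $n,n-1,\dots,1$. $\mathcal{V}(\mathcal{A},\mathcal{B})$ (vertical merge) is the class of permutations whose sequence is a concatenation $s_1s_2$ of two (possibly empty) sequences with $s_1$ order-isomorphic to a permutation of $\mathcal{A}$ and $s_2$ order-isomorphic to a permutation of $\mathcal{B}$. $\mathcal{H}$ is the class of permutations whose sequence can be partitioned into two (possibly empty) increasing subsequences $s_1,s_2$ such that every element (value) of $s_1$ is smaller than every element of $s_2$. *)

theory Defs
  imports "HOL-Combinatorics.Multiset_Permutations" "HOL-Library.Sublist"
begin

text \<open>
  A permutation of order \<open>n\<close> is represented by its sequence of values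
  \<open>\<pi>(1), \<dots>, \<pi>(n)\<close>, a list of naturals. Values are 1-based as in the mathematics, while
  list positions are 0-based, so \<open>\<pi>(i)\<close> is \<open>\<pi> ! (i - 1)\<close>.
\<close>

definition is_perm :: "nat list \<Rightarrow> bool" where
  "is_perm p \<longleftrightarrow> p \<in> permutations_of_set {1..length p}"

definition order_iso :: "nat list \<Rightarrow> nat list \<Rightarrow> bool" where
  "order_iso xs ys \<longleftrightarrow> length xs = length ys \<and>
     (\<forall>i<length xs. \<forall>j<length xs. xs ! i < xs ! j \<longleftrightarrow> ys ! i < ys ! j)"

definition contained :: "nat list \<Rightarrow> nat list \<Rightarrow> bool" where
  "contained p q \<longleftrightarrow> (\<exists>s. subseq s q \<and> order_iso s p)"

definition perm_class :: "nat list set \<Rightarrow> bool" where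
  "perm_class C \<longleftrightarrow> (\<forall>q\<in>C. is_perm q) \<and>
     (\<forall>q\<in>C. \<forall>p. is_perm p \<and> contained p q \<longrightarrow> p \<in> C)"

definition Av :: "nat list \<Rightarrow> nat list set" where
  "Av p = {q. is_perm q \<and> \<not> contained p q}"

text \<open>Only meaningful for permutations of the same order.\<close>
definition perm_comp :: "nat list \<Rightarrow> nat list \<Rightarrow> nat list" where
  "perm_comp p q = map (\<lambda>i. p ! (i - 1)) q"

definition class_comp :: "nat list set \<Rightarrow> nat list set \<Rightarrow> nat list set"
    (infixl "\<circ>\<^sub>c" 60) where
  "A \<circ>\<^sub>c B = {perm_comp p q | p q. p \<in> A \<and> q \<in> B \<and> length p = length q}"

definition two_composable :: "nat list set \<Rightarrow> bool" where
  "two_composable C \<longleftrightarrow> perm_class C \<and>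
     (\<exists>C1 C2. perm_class C1 \<and> perm_class C2 \<and> C1 \<subset> C \<and> C2 \<subset> C \<and> C \<subseteq> C1 \<circ>\<^sub>c C2)"

definition perm_sum :: "nat list \<Rightarrow> nat list \<Rightarrow> nat list" (infixl "\<oplus>" 65) where
  "p \<oplus> q = p @ map (\<lambda>x. x + length p) q"

definition decr_perm :: "nat \<Rightarrow> nat list" ("\<delta>") where
  "\<delta> n = rev [1..<Suc n]"

definition vmerge :: "nat list set \<Rightarrow> nat list set \<Rightarrow> nat list set" ("\<V>") where
  "\<V> A B = {p. is_perm p \<and> (\<exists>s1 s2. p = s1 @ s2 \<and>
     (\<exists>a\<in>A. order_iso s1 a) \<and> (\<exists>b\<in>B. order_iso s2 b))}"

text \<open>
  \<^term>\<open>p \<in> shuffles s1 s2\<close> says that \<open>p\<close> is an interleaving of \<open>s1\<close> and \<open>s2\<close>, i.e.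
  that its positions can be partitioned into two subsequences \<open>s1\<close> and \<open>s2\<close>.
\<close>
definition horiz_class :: "nat list set" ("\<H>") where
  "\<H> = {p. is_perm p \<and> (\<exists>s1 s2. p \<in> shuffles s1 s2 \<and>
     sorted_wrt (<) s1 \<and> sorted_wrt (<) s2 \<and> (\<forall>x\<in>set s1. \<forall>y\<in>set s2. x < y))}"

end

theory Submission
  imports Defs
begin

text \<open>
  Colour the entries of \<open>w \<in> Av (\<alpha> \<oplus> \<beta> \<oplus> \<gamma>)\<close> from left to right: an entry becomes blue if a smaller
  blue entry precedes it or if colouring it red would create a red copy of \<open>\<alpha> \<oplus> \<beta>\<close>, and red
  otherwise. The red entries avoid \<open>\<alpha> \<oplus> \<beta>\<close>, and the blue ones turn out to avoid \<open>\<beta> \<oplus> \<gamma>\<close>. Moreover a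
  red entry is smaller than every blue entry preceding it. Hence, for decreasing \<open>\<beta>\<close>, a copy of
  \<open>\<alpha> \<oplus> \<beta> \<oplus> \<gamma>\<close> in ``red followed by blue'' whose \<open>\<beta>\<close> is cut into a red and a blue part
  has its entries in the same order in \<open>w\<close>, which is impossible. Since \<open>w\<close> is an
  interleaving of its red and blue subsequences, it is obtained from their concatenation by
  composing with an element of \<open>\<H>\<close>.

  Both classes of the composition are proper: \<open>321\<close> avoids \<open>\<alpha> \<oplus> \<beta> \<oplus> \<gamma>\<close> but is not in \<open>\<H>\<close>, and the
  skew sum of \<open>\<alpha> \<oplus> \<beta>\<close> (above and to the left) and \<open>\<beta> \<oplus> \<gamma>\<close> avoids \<open>\<alpha> \<oplus> \<beta> \<oplus> \<gamma>\<close> but is not in the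
  vertical merge.
\<close>

section \<open>Order isomorphism, subsequences and containment\<close>

lemma is_perm_iff: "is_perm p \<longleftrightarrow> distinct p \<and> set p = {1..length p}"
  by (auto simp: is_perm_def permutations_of_set_def)

lemma order_iso_sym: "order_iso xs ys \<Longrightarrow> order_iso ys xs"
  by (simp add: order_iso_def)

lemma order_iso_trans: "order_iso xs ys \<Longrightarrow> order_iso ys zs \<Longrightarrow> order_iso xs zs"
  by (simp add: order_iso_def)

lemma order_iso_map: "strict_mono_on (set xs) f \<Longrightarrow> order_iso xs (map f xs)"
  by (auto simp: order_iso_def strict_mono_on_less)

text \<open>Distinctness makes the position of an entry of \<open>xs\<close> unique, so
  \<open>f\<close> can send the entry to the one at the same position of \<open>ys\<close>.\<close>

lemma order_iso_imp_map:
  assumes "distinct xs" "order_iso xs ys"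
  obtains f where "strict_mono_on (set xs) f" "ys = map f xs"
proof
  define f where "f x = ys ! (THE i. i < length xs \<and> xs ! i = x)" for x
  have f: "f (xs ! i) = ys ! i" if "i < length xs" for i
    unfolding f_def using that assms(1)
    by (intro arg_cong[where f = "nth ys"] the_equality) (auto simp: nth_eq_iff_index_eq)
  show "strict_mono_on (set xs) f"
    using assms(2) by (auto simp: strict_mono_on_def in_set_conv_nth f order_iso_def)
  show "ys = map f xs"
    using assms(2) by (auto intro!: nth_equalityI simp: f order_iso_def)
qed

lemma order_iso_distinct:
  assumes "order_iso xs ys"
  shows "distinct xs \<longleftrightarrow> distinct ys"
  using assms unfolding order_iso_def distinct_conv_nth
  by (metis less_irrefl linorder_neqE_nat)

lemma set_mono_subseq: "subseq xs ys \<Longrightarrow> set xs \<subseteq> set ys"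
  unfolding subseq_conv_nths using set_nths_subset by metis

lemma distinct_subseq: "subseq xs ys \<Longrightarrow> distinct ys \<Longrightarrow> distinct xs"
  by (auto simp: subseq_conv_nths)

lemma order_iso_take: "order_iso xs ys \<Longrightarrow> order_iso (take k xs) (take k ys)"
  by (simp add: order_iso_def)

lemma order_iso_drop: "order_iso xs ys \<Longrightarrow> order_iso (drop k xs) (drop k ys)"
  by (simp add: order_iso_def)

lemma order_iso_subseq:
  assumes "distinct xs" "order_iso xs ys" "subseq u xs"
  obtains v where "subseq v ys" "order_iso u v"
proof -
  obtain f where f: "strict_mono_on (set xs) f" "ys = map f xs"
    using order_iso_imp_map[OF assms(1,2)] .
  have "set u \<subseteq> set xs"
    using assms(3) by (rule set_mono_subseq)
  then have "order_iso u (map f u)"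
    using f(1) by (intro order_iso_map) (auto simp: strict_mono_on_def)
  moreover have "subseq (map f u) ys"
    using assms(3) f(2) by (simp add: subseq_map)
  ultimately show thesis using that by blast
qed

lemma contained_subseq: "contained p xs \<Longrightarrow> subseq xs ys \<Longrightarrow> contained p ys"
  unfolding contained_def by (blast intro: subseq_order.order_trans)

lemma contained_order_iso:
  assumes "distinct xs" "order_iso xs ys"
  shows "contained p xs \<longleftrightarrow> contained p ys"
proof -
  \<comment> \<open>One direction suffices, as \<open>order_iso\<close> is symmetric and preserves
    distinctness.\<close>
  have "contained p v" if "distinct u" "order_iso u v" "contained p u" for u v
    using that order_iso_subseq[OF that(1,2)]
    unfolding contained_def by (metis order_iso_sym order_iso_trans)
  then show ?thesis
    using assms order_iso_sym order_iso_distinct by blast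
qed

lemma contained_trans:
  assumes "contained p q" "contained q r" "distinct r"
  shows "contained p r"
proof -
  obtain s where s: "subseq s r" "order_iso s q"
    using assms(2) by (auto simp: contained_def)
  then have "contained p s"
    using assms(1,3) contained_order_iso distinct_subseq by blast
  then show ?thesis using s(1) by (rule contained_subseq)
qed

text \<open>Each entry is replaced by its rank \<open>rk\<close>, the number of entries of
  \<open>s\<close> that do not exceed it.\<close>

lemma ex_is_perm_order_iso:
  assumes "distinct s"
  obtains p where "is_perm p" "order_iso s p"
proof
  define rk where "rk x = card {y \<in> set s. y \<le> x}" for x
  have mono: "strict_mono_on (set s) rk"
    unfolding rk_def by (intro strict_mono_onI psubset_card_mono) (auto dest: leD)
  then show "order_iso s (map rk s)" by (rule order_iso_map)
  have inj: "inj_on rk (set s)" using mono by (rule strict_mono_on_imp_inj_on)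
  have "rk ` set s \<subseteq> {1..length s}"
  proof
    fix k assume "k \<in> rk ` set s"
    then obtain x where x: "x \<in> set s" "k = rk x" by auto
    have "rk x > 0" using x(1) by (auto simp: rk_def card_gt_0_iff)
    moreover have "rk x \<le> card (set s)"
      unfolding rk_def by (intro card_mono) auto
    ultimately show "k \<in> {1..length s}"
      using x(2) assms by (simp add: distinct_card Suc_le_eq)
  qed
  moreover have "card (rk ` set s) = length s"
    using inj assms by (simp add: card_image distinct_card)
  ultimately have "rk ` set s = {1..length s}"
    by (intro card_subset_eq) auto
  then show "is_perm (map rk s)"
    using inj assms by (simp add: is_perm_iff distinct_map)
qed

section \<open>Copies of sums\<close>

lemma is_perm_perm_sum:
  assumes "is_perm p" "is_perm q"
  shows "is_perm (p \<oplus> q)"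
proof -
  have "(\<lambda>x. x + length p) ` {1..length q} = {1 + length p..length q + length p}"
    by (rule image_add_atLeastAtMost')
  then show ?thesis
    using assms by (fastforce simp: is_perm_iff perm_sum_def distinct_map)
qed

lemma is_perm_decr_perm: "is_perm (\<delta> n)"
  by (auto simp: is_perm_iff decr_perm_def)

text \<open>The entries of \<open>p\<close> are at most \<open>length p\<close> and the shifted
  entries of \<open>q\<close> exceed it, so cutting \<open>s\<close> after \<open>length p\<close>
  entries gives a lower and an upper block.\<close>

lemma order_iso_perm_sum:
  assumes "is_perm p" "is_perm q"
  shows "order_iso s (p \<oplus> q) \<longleftrightarrow>
    (\<exists>u v. s = u @ v \<and> order_iso u p \<and> order_iso v q \<and> (\<forall>x\<in>set u. \<forall>y\<in>set v. x < y))"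
proof
  have p: "p ! i \<in> {1..length p}" if "i < length p" for i
    using assms(1) that nth_mem unfolding is_perm_iff by metis
  have q: "q ! i \<in> {1..length q}" if "i < length q" for i
    using assms(2) that nth_mem unfolding is_perm_iff by metis
  { assume s: "order_iso s (p \<oplus> q)"
    let ?u = "take (length p) s" and ?v = "drop (length p) s"
    have len: "length s = length p + length q"
      using s by (simp add: order_iso_def perm_sum_def)
    have "order_iso ?u p"
      using order_iso_take[OF s, of "length p"] by (simp add: perm_sum_def)
    moreover have "order_iso ?v q"
      using order_iso_drop[OF s, of "length p"] len by (simp add: perm_sum_def order_iso_def)
    moreover have "\<forall>x\<in>set ?u. \<forall>y\<in>set ?v. x < y"
    proof (intro ballI)
      fix x y assume "x \<in> set ?u" "y \<in> set ?v"
      then obtain i j where ij: "i < length p" "x = s ! i" "j < length q" "y = s ! (length p + j)"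
        using len by (auto simp: in_set_conv_nth)
      then have "(p \<oplus> q) ! i < (p \<oplus> q) ! (length p + j)"
        using p[of i] q[of j] by (simp add: perm_sum_def nth_append)
      then show "x < y" using s ij len by (simp add: order_iso_def)
    qed
    ultimately show "\<exists>u v. s = u @ v \<and> order_iso u p \<and> order_iso v q \<and>
      (\<forall>x\<in>set u. \<forall>y\<in>set v. x < y)"
      by (metis append_take_drop_id) }
  { assume "\<exists>u v. s = u @ v \<and> order_iso u p \<and> order_iso v q \<and>
      (\<forall>x\<in>set u. \<forall>y\<in>set v. x < y)"
    then obtain u v where uv: "s = u @ v" "order_iso u p" "order_iso v q"
      "\<forall>x\<in>set u. \<forall>y\<in>set v. x < y" by blast
    have len: "length u = length p" "length v = length q"
      using uv by (auto simp: order_iso_def)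
    have *: "s ! i < s ! j \<longleftrightarrow> (p \<oplus> q) ! i < (p \<oplus> q) ! j"
      if "i < length p + length q" "j < length p + length q" for i j
    proof -
      consider "i < length p" "j < length p" | "i < length p" "j \<ge> length p"
        | "i \<ge> length p" "j < length p" | "i \<ge> length p" "j \<ge> length p" by linarith
      then show ?thesis
      proof cases
        case 1
        then show ?thesis using uv(1,2) len by (simp add: nth_append perm_sum_def order_iso_def)
      next
        case 2
        then have "u ! i < v ! (j - length p)" using uv(4) len that by simp
        moreover have "p ! i < q ! (j - length p) + length p"
          using 2 that p[of i] q[of "j - length p"] by force
        ultimately show ?thesis using 2 that uv(1) len by (simp add: nth_append perm_sum_def)
      next
        case 3
        then have "u ! j < v ! (i - length p)" using uv(4) len that by simp
        moreover have "p ! j < q ! (i - length p) + length p"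
          using 3 that p[of j] q[of "i - length p"] by force
        ultimately show ?thesis using 3 that uv(1) len by (simp add: nth_append perm_sum_def)
      next
        case 4
        then show ?thesis
          using uv(1,3) len that by (simp add: nth_append perm_sum_def order_iso_def)
      qed
    qed
    show "order_iso s (p \<oplus> q)"
      unfolding order_iso_def using * uv(1) len by (simp add: perm_sum_def) }
qed

lemma contained_perm_sum:
  assumes "is_perm p" "is_perm q"
  shows "contained (p \<oplus> q) w \<longleftrightarrow> (\<exists>u v. subseq (u @ v) w \<and> order_iso u p \<and>
    order_iso v q \<and> (\<forall>x\<in>set u. \<forall>y\<in>set v. x < y))"
  unfolding contained_def order_iso_perm_sum[OF assms] by blast

lemma contained_perm_sum3:
  assumes "is_perm p" "is_perm q" "is_perm r"
  shows "contained (p \<oplus> q \<oplus> r) w \<longleftrightarrow> (\<exists>a b c. subseq (a @ b @ c) w \<and>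
    order_iso a p \<and> order_iso b q \<and> order_iso c r \<and> (\<forall>x\<in>set a. \<forall>y\<in>set b. x < y) \<and>
    (\<forall>x\<in>set a \<union> set b. \<forall>y\<in>set c. x < y))" (is "?L \<longleftrightarrow> ?R")
proof
  assume ?L
  then obtain u c where u: "subseq (u @ c) w" "order_iso u (p \<oplus> q)" "order_iso c r"
      "\<forall>x\<in>set u. \<forall>y\<in>set c. x < y"
    using contained_perm_sum[OF is_perm_perm_sum[OF assms(1,2)] assms(3)] by blast
  moreover obtain a b where "u = a @ b" "order_iso a p" "order_iso b q"
      "\<forall>x\<in>set a. \<forall>y\<in>set b. x < y"
    using u(2) order_iso_perm_sum[OF assms(1,2)] by blast
  ultimately show ?R by auto
next
  assume ?R
  then obtain a b c where abc: "subseq ((a @ b) @ c) w" "order_iso a p" "order_iso b q"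
    "order_iso c r" "\<forall>x\<in>set a. \<forall>y\<in>set b. x < y" "\<forall>x\<in>set (a @ b). \<forall>y\<in>set c. x < y"
    by auto
  then have "order_iso (a @ b) (p \<oplus> q)"
    using order_iso_perm_sum[OF assms(1,2)] by blast
  then show ?L
    using abc contained_perm_sum[OF is_perm_perm_sum[OF assms(1,2)] assms(3)] by blast
qed

lemma order_iso_decr_perm:
  assumes "order_iso s (\<delta> n)"
  shows "sorted_wrt (>) s"
proof -
  have len: "length s = n" using assms by (simp add: order_iso_def decr_perm_def)
  have "\<delta> n ! j < \<delta> n ! i" if "i < j" "j < n" for i j
    using that by (simp add: decr_perm_def rev_nth del: upt_Suc)
  then show ?thesis
    using assms len by (simp add: order_iso_def sorted_wrt_iff_nth_less)
qed

section \<open>Subsequences described by the relative position of pairs\<close>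

text \<open>
  A constant of its own, since otherwise \<open>subseq_iff_sorted_wrt\<close> would loop as a rewrite rule.
\<close>
definition precedes :: "'a list \<Rightarrow> 'a \<Rightarrow> 'a \<Rightarrow> bool" where
  "precedes w x y \<longleftrightarrow> subseq [x, y] w"

lemma precedes_Nil [simp]: "\<not> precedes [] x y"
  by (simp add: precedes_def)

lemma precedes_Cons:
  "precedes (z # w) x y \<longleftrightarrow> (if x = z then y \<in> set w else precedes w x y)"
  by (simp add: precedes_def subseq_singleton_left)

lemma precedesD: "precedes w x y \<Longrightarrow> x \<in> set w \<and> y \<in> set w"
  using set_mono_subseq[of "[x, y]" w] by (simp add: precedes_def)

text \<open>In a list without repetitions, being a subsequence is a condition on pairs. To glue two
  subsequences into one, it is then enough to check the pairs across the seam, by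
  \<open>sorted_wrt_append\<close>.\<close>

lemma subseq_iff_sorted_wrt:
  assumes "distinct w"
  shows "subseq u w \<longleftrightarrow> set u \<subseteq> set w \<and> sorted_wrt (precedes w) u"
  using assms
proof (induction w arbitrary: u)
  case Nil
  then show ?case by (cases u) auto
next
  case (Cons z w)
  \<comment> \<open>Since \<open>z\<close> does not occur in \<open>w\<close>, prepending it leaves
    the relative positions of entries of \<open>w\<close> unchanged.\<close>
  have rel: "sorted_wrt (precedes (z # w)) v \<longleftrightarrow> sorted_wrt (precedes w) v"
    if "set v \<subseteq> set w" for v
  proof -
    have "precedes (z # w) x y \<longleftrightarrow> precedes w x y" if "x \<in> set v" for x y
      using that \<open>set v \<subseteq> set w\<close> Cons.prems unfolding precedes_Cons by auto
    then show ?thesis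
      by (induction v) simp_all
  qed
  show ?case
  proof (cases u)
    case Nil
    then show ?thesis by simp
  next
    case u: (Cons x v)
    show ?thesis
    proof (cases "x = z")
      case True
      have "subseq u (z # w) \<longleftrightarrow> subseq v w" using u True by simp
      also have "\<dots> \<longleftrightarrow> set v \<subseteq> set w \<and> sorted_wrt (precedes w) v"
        by (rule Cons.IH) (use Cons.prems in simp)
      also have "\<dots> \<longleftrightarrow> set v \<subseteq> set w \<and> sorted_wrt (precedes (z # w)) v"
        using rel by blast
      also have "\<dots> \<longleftrightarrow> set u \<subseteq> set (z # w) \<and> sorted_wrt (precedes (z # w)) u"
        unfolding u sorted_wrt.simps precedes_Cons True by auto
      finally show ?thesis .
    next
      case False
      have "subseq u (z # w) \<longleftrightarrow> subseq u w" using u False by simp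
      also have "\<dots> \<longleftrightarrow> set u \<subseteq> set w \<and> sorted_wrt (precedes w) u"
        by (rule Cons.IH) (use Cons.prems in simp)
      also have "\<dots> \<longleftrightarrow> set u \<subseteq> set w \<and> sorted_wrt (precedes (z # w)) u"
        using rel by blast
      also have "\<dots> \<longleftrightarrow> set u \<subseteq> set (z # w) \<and> sorted_wrt (precedes (z # w)) u"
      proof -
        \<comment> \<open>As \<open>x\<close> is not \<open>z\<close>, it lies in \<open>w\<close>,
          and so does everything that \<open>x\<close> precedes.\<close>
        have "set u \<subseteq> set w" if "set u \<subseteq> set (z # w)" "\<forall>y\<in>set v. precedes w x y"
          using that False precedesD[of w x] unfolding u by auto
        then show ?thesis
          unfolding u sorted_wrt.simps precedes_Cons using False by (auto simp: subset_insertI2)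
      qed
      finally show ?thesis .
    qed
  qed
qed

lemma precedes_trans:
  assumes "distinct w" "precedes w x y" "precedes w y z"
  shows "precedes w x z"
  using assms
proof (induction w)
  case (Cons a w)
  then show ?case
    using precedesD[of w x y] precedesD[of w y z]
    unfolding precedes_Cons by (auto split: if_splits)
qed simp

lemma precedes_total:
  assumes "x \<in> set w" "y \<in> set w" "x \<noteq> y"
  shows "precedes w x y \<or> precedes w y x"
  using assms
proof (induction w)
  case (Cons z w)
  then show ?case unfolding precedes_Cons by auto
qed simp

lemma precedes_snoc:
  "precedes (w @ [z]) x y \<longleftrightarrow> precedes w x y \<or> x \<in> set w \<and> y = z"
proof (induction w)
  case (Cons a w)
  then show ?case unfolding append_Cons precedes_Cons by auto
qed (simp add: precedes_Cons)

section \<open>The greedy colouring\<close>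

text \<open>The last property records why an entry is blue: going back through smaller blue entries
  ends at some \<open>y\<close> that would have completed a copy of \<open>P\<close> with otherwise
  red entries. That \<open>P\<close> is non-empty settles the empty list.\<close>

lemma greedy_colouring:
  assumes "distinct w" "P \<noteq> []"
  shows "\<exists>R \<subseteq> set w.
    (\<forall>r\<in>R. \<forall>b\<in>set w - R. precedes w b r \<longrightarrow> r < b) \<and>
    \<not> contained P (filter (\<lambda>x. x \<in> R) w) \<and>
    (\<forall>x\<in>set w - R. \<exists>y\<in>set w - R. y \<le> x \<and> (y = x \<or> precedes w y x) \<and>
       (\<exists>u. set u \<subseteq> R \<and> subseq (u @ [y]) w \<and> order_iso (u @ [y]) P))"
  using assms(1)
proof (induction w rule: rev_induct)
  case Nil
  have "\<not> contained P []"
    using assms(2) by (auto simp: contained_def order_iso_def)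
  then show ?case by simp
next
  case (snoc x w)
  then obtain R where R: "R \<subseteq> set w"
    and below: "\<And>r b. r \<in> R \<Longrightarrow> b \<in> set w - R \<Longrightarrow> precedes w b r \<Longrightarrow> r < b"
    and avoid: "\<not> contained P (filter (\<lambda>x. x \<in> R) w)"
    and witness: "\<And>x. x \<in> set w - R \<Longrightarrow> \<exists>y\<in>set w - R. y \<le> x \<and> (y = x \<or> precedes w y x) \<and>
       (\<exists>u. set u \<subseteq> R \<and> subseq (u @ [y]) w \<and> order_iso (u @ [y]) P)"
    by auto
  have x: "x \<notin> set w" "x \<notin> R" using snoc.prems R by auto
  note subseq_w = subseq_rev_drop_many[of _ w "[x]"]
  have precedes_w: "precedes w y z \<Longrightarrow> precedes (w @ [x]) y z" for y z
    by (simp add: precedes_snoc)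
  show ?case
  \<comment> \<open>This is the rule for the new entry: \<open>x\<close> turns blue if the condition
    holds, leaving \<open>R\<close> unchanged, and red otherwise.\<close>
  proof (cases "(\<exists>b\<in>set w - R. b < x) \<or> contained P (filter (\<lambda>x. x \<in> R) w @ [x])")
    case True
    have "\<exists>y\<in>set (w @ [x]) - R. y \<le> x \<and> (y = x \<or> precedes (w @ [x]) y x) \<and>
       (\<exists>u. set u \<subseteq> R \<and> subseq (u @ [y]) (w @ [x]) \<and> order_iso (u @ [y]) P)"
      using True
    proof
      assume "\<exists>b\<in>set w - R. b < x"
      then obtain b where b: "b \<in> set w - R" "b < x" by blast
      \<comment> \<open>The witness of \<open>b\<close> also serves for \<open>x\<close>: it is at
        most \<open>b\<close>, and \<open>x\<close> comes last.\<close>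
      obtain y u where y: "y \<in> set w - R" "y \<le> b" "set u \<subseteq> R" "subseq (u @ [y]) w"
          "order_iso (u @ [y]) P"
        using witness[OF b(1)] by blast
      then have "y \<in> set (w @ [x]) - R" "y \<le> x" "precedes (w @ [x]) y x"
        using b(2) unfolding precedes_snoc by auto
      then show ?thesis using y(3,5) subseq_w[OF y(4)] by blast
    next
      assume "contained P (filter (\<lambda>x. x \<in> R) w @ [x])"
      then obtain s where s: "subseq s (filter (\<lambda>x. x \<in> R) w @ [x])" "order_iso s P"
        by (auto simp: contained_def)
      then obtain u v where uv: "s = u @ v" "subseq u (filter (\<lambda>x. x \<in> R) w)" "subseq v [x]"
        by (elim subseq_appendE)
      \<comment> \<open>Without \<open>x\<close> the copy would consist of red entries of
        \<open>w\<close>, against \<open>avoid\<close>. Hence \<open>x\<close> ends the copy and is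
        its own witness.\<close>
      have "v \<noteq> []" using uv(1,2) s(2) avoid by (auto simp: contained_def)
      then have v: "v = [x]" using uv(3) by (cases v) (auto split: if_splits)
      have "set u \<subseteq> R" using set_mono_subseq[OF uv(2)] by auto
      moreover have "subseq u w" using uv(2) subseq_filter_left by (rule subseq_order.order_trans)
      ultimately show ?thesis using x s(2) uv(1) v
        by (intro bexI[of _ x] conjI exI[of _ u]) auto
    qed
    then have "\<exists>y\<in>set (w @ [x]) - R. y \<le> z \<and> (y = z \<or> precedes (w @ [x]) y z) \<and>
       (\<exists>u. set u \<subseteq> R \<and> subseq (u @ [y]) (w @ [x]) \<and> order_iso (u @ [y]) P)"
      if "z \<in> set (w @ [x]) - R" for z
    proof (cases "z = x")
      case False
      then have z: "z \<in> set w - R" using that by auto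
      obtain y u where "y \<in> set w - R" "y \<le> z" "y = z \<or> precedes w y z" "set u \<subseteq> R"
          "subseq (u @ [y]) w" "order_iso (u @ [y]) P"
        using witness[OF z] by blast
      then show ?thesis using subseq_w precedes_w by (intro bexI[of _ y] conjI exI[of _ u]) auto
    qed simp
    moreover have "r < b" if "r \<in> R" "b \<in> set (w @ [x]) - R" "precedes (w @ [x]) b r" for r b
      using that below[of r b] x precedesD[of w b r] unfolding precedes_snoc by auto
    moreover have "filter (\<lambda>x. x \<in> R) (w @ [x]) = filter (\<lambda>x. x \<in> R) w"
      using x by simp
    ultimately show ?thesis
      using R avoid by (intro exI[of _ R]) (auto simp del: filter_append)
  next
    case False
    let ?R = "insert x R"
    have "set (w @ [x]) - ?R = set w - R" using x by auto
    moreover have "\<exists>y\<in>set w - R. y \<le> z \<and> (y = z \<or> precedes (w @ [x]) y z) \<and>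
       (\<exists>u. set u \<subseteq> ?R \<and> subseq (u @ [y]) (w @ [x]) \<and> order_iso (u @ [y]) P)"
      if z: "z \<in> set w - R" for z
    proof -
      obtain y u where "y \<in> set w - R" "y \<le> z" "y = z \<or> precedes w y z" "set u \<subseteq> R"
          "subseq (u @ [y]) w" "order_iso (u @ [y]) P"
        using witness[OF z] by blast
      then show ?thesis using subseq_w precedes_w by (intro bexI[of _ y] conjI exI[of _ u]) auto
    qed
    moreover have "r < b" if "r \<in> ?R" "b \<in> set w - R" "precedes (w @ [x]) b r" for r b
    proof (cases "r = x")
      case True
      \<comment> \<open>A blue entry below \<open>x\<close> would have turned \<open>x\<close> blue;
        here \<open>False\<close> is the failure of the colouring condition.\<close>
      then show ?thesis using False that(2) x(1) by (metis DiffD1 linorder_neqE_nat)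
    next
      case False
      then show ?thesis using that below unfolding precedes_snoc by auto
    qed
    moreover have "filter (\<lambda>y. y \<in> ?R) (w @ [x]) = filter (\<lambda>x. x \<in> R) w @ [x]"
      using x by (auto intro: filter_cong)
    moreover have "?R \<subseteq> set (w @ [x])" using R by auto
    ultimately show ?thesis
      using False by (intro exI[of _ ?R]) (simp del: filter_append)
  qed
qed

text \<open>To the least entry of the \<open>\<beta>\<close>-part of a blue copy of
  \<open>\<beta> \<oplus> \<gamma>\<close>, the colouring attaches a copy of
  \<open>\<alpha> \<oplus> \<beta>\<close> ending at or before it. Parts of the two copies combine
  to the forbidden pattern.\<close>

lemma sum_avoider_colouring:
  assumes perm: "is_perm \<alpha>" "is_perm \<beta>" "is_perm \<gamma>" and "\<beta> \<noteq> []"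
    and w: "distinct w" "\<not> contained (\<alpha> \<oplus> \<beta> \<oplus> \<gamma>) w"
  shows "\<exists>R. (\<forall>r\<in>R. \<forall>b\<in>set w - R. precedes w b r \<longrightarrow> r < b) \<and>
    \<not> contained (\<alpha> \<oplus> \<beta>) (filter (\<lambda>x. x \<in> R) w) \<and>
    \<not> contained (\<beta> \<oplus> \<gamma>) (filter (\<lambda>x. x \<notin> R) w)"
proof -
  have "\<alpha> \<oplus> \<beta> \<noteq> []" using \<open>\<beta> \<noteq> []\<close> by (simp add: perm_sum_def)
  from greedy_colouring[OF w(1) this] obtain R where R: "R \<subseteq> set w"
    and below: "\<And>r b. r \<in> R \<Longrightarrow> b \<in> set w - R \<Longrightarrow> precedes w b r \<Longrightarrow> r < b"
    and avoid: "\<not> contained (\<alpha> \<oplus> \<beta>) (filter (\<lambda>x. x \<in> R) w)"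
    and witness: "\<And>x. x \<in> set w - R \<Longrightarrow> \<exists>y\<in>set w - R. y \<le> x \<and> (y = x \<or> precedes w y x) \<and>
       (\<exists>u. set u \<subseteq> R \<and> subseq (u @ [y]) w \<and> order_iso (u @ [y]) (\<alpha> \<oplus> \<beta>))"
    by auto
  note sub_iff = subseq_iff_sorted_wrt[OF w(1)]
  note trans = precedes_trans[OF w(1)]
  note contained3 = contained_perm_sum3[OF perm]
  have "\<not> contained (\<beta> \<oplus> \<gamma>) (filter (\<lambda>x. x \<notin> R) w)"
  proof
    assume "contained (\<beta> \<oplus> \<gamma>) (filter (\<lambda>x. x \<notin> R) w)"
    then obtain t c where tc: "subseq (t @ c) (filter (\<lambda>x. x \<notin> R) w)" "order_iso t \<beta>"
        "order_iso c \<gamma>" "\<forall>x\<in>set t. \<forall>y\<in>set c. x < y"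
      using contained_perm_sum[OF perm(2,3)] by blast
    have blue: "set (t @ c) \<subseteq> set w - R" using set_mono_subseq[OF tc(1)] by auto
    have tcw: "subseq (t @ c) w"
      using tc(1) subseq_filter_left by (rule subseq_order.order_trans)
    have "t \<noteq> []" using tc(2) \<open>\<beta> \<noteq> []\<close> by (auto simp: order_iso_def)
    \<comment> \<open>With the minimum, the bound \<open>y \<le> m\<close> puts \<open>y\<close>,
      and hence everything in \<open>a\<close>, below \<open>c\<close> and weakly below
      \<open>t\<close>.\<close>
    define m where "m = Min (set t)"
    have m: "m \<in> set t" "\<And>x. x \<in> set t \<Longrightarrow> m \<le> x"
      using \<open>t \<noteq> []\<close> by (simp_all add: m_def)
    obtain y u where y: "y \<in> set w - R" "y \<le> m" "y = m \<or> precedes w y m" "set u \<subseteq> R"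
        "subseq (u @ [y]) w" "order_iso (u @ [y]) (\<alpha> \<oplus> \<beta>)"
      using witness[of m] m(1) blue by auto
    obtain a b where ab: "u @ [y] = a @ b" "order_iso a \<alpha>" "order_iso b \<beta>"
        "\<forall>x\<in>set a. \<forall>y\<in>set b. x < y"
      using y(6) order_iso_perm_sum[OF perm(1,2)] by blast
    have "b \<noteq> []" using ab(3) \<open>\<beta> \<noteq> []\<close> by (auto simp: order_iso_def)
    \<comment> \<open>The only blue entry \<open>y\<close> comes last, so it ends \<open>b\<close>,
      and all of \<open>b'\<close> is red.\<close>
    then obtain b' where b': "b = b' @ [y]" "u = a @ b'"
      using ab(1) by (metis append_assoc append_butlast_last_id last_appendR last_snoc butlast_append butlast_snoc)
    have abw: "subseq (a @ b) w" using y(5) ab(1) by simp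
    \<comment> \<open>If the copy \<open>b\<close> of \<open>\<beta>\<close> is below \<open>c\<close>, then \<open>a @ b @ c\<close> is a copy of the forbidden pattern. If not,
      some red \<open>z\<close> in \<open>b\<close> is above the whole of \<open>t\<close>, so it precedes \<open>t\<close>, and \<open>a @ t @ c\<close> is a copy.\<close>
    have "contained (\<alpha> \<oplus> \<beta> \<oplus> \<gamma>) w"
    proof (cases "\<forall>z\<in>set b. \<forall>v\<in>set c. z < v")
      case True
      \<comment> \<open>Positions are compared along the chain \<open>z\<close>, \<open>y\<close>,
        \<open>m\<close>, \<open>v\<close>, in which the first two links may be equalities.\<close>
      have "precedes w z v" if "z \<in> set (a @ b)" "v \<in> set c" for z v
      proof -
        have "precedes w m v" using tcw m(1) that(2) unfolding sub_iff by (auto simp: sorted_wrt_append)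
        then have yv: "precedes w y v" using y(3) trans by blast
        show ?thesis
        proof (cases "z = y")
          case False
          then have "precedes w z y"
            using that(1) y(5) unfolding sub_iff b' by (auto simp: sorted_wrt_append b' ab(1))
          then show ?thesis using yv trans by blast
        qed (use yv in simp)
      qed
      then have "subseq (a @ b @ c) w"
        using abw tcw unfolding sub_iff by (auto simp: sorted_wrt_append)
      moreover have "\<forall>x\<in>set a \<union> set b. \<forall>y\<in>set c. x < y"
        using True ab(4) \<open>b \<noteq> []\<close> by (metis UnE hd_in_set order.strict_trans)
      ultimately show ?thesis unfolding contained3 using ab tc by blast
    next
      case False
      then obtain z v where z: "z \<in> set b" "v \<in> set c" "v \<le> z" by (auto simp: not_less)
      \<comment> \<open>From \<open>y \<le> m < v \<le> z\<close> it follows that \<open>z\<close>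
        is not the blue entry \<open>y\<close>.\<close>
      have "y < v" using y(2) tc(4) m(1) z(2) by fastforce
      then have "z \<in> set b'" using z b' by auto
      then have zR: "z \<in> R" using y(4) b' by auto
      let ?t = "hd t"
      have t: "?t \<in> set t" using \<open>t \<noteq> []\<close> by simp
      have "?t < z" using t tc(4) z by fastforce
      then have "\<not> precedes w ?t z" using below[OF zR, of ?t] t blue by auto
      then have zt: "precedes w z ?t"
        using precedes_total[of z w ?t] \<open>?t < z\<close> zR R t blue by auto
      have "precedes w x v" if "x \<in> set a" "v \<in> set (t @ c)" for x v
      proof -
        have "precedes w x z" using abw that(1) z(1) unfolding sub_iff by (auto simp: sorted_wrt_append)
        then have xt: "precedes w x ?t" using zt trans by blast
        have "v = ?t \<or> precedes w ?t v"
          using tcw that(2) \<open>t \<noteq> []\<close> unfolding sub_iff by (cases t) auto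
        then show ?thesis using xt trans by blast
      qed
      then have "subseq (a @ t @ c) w"
        using abw tcw unfolding sub_iff by (auto simp: sorted_wrt_append)
      moreover have at: "\<forall>x\<in>set a. \<forall>v\<in>set t. x < v"
        using ab(4) b'(1) y(2) m(2) by fastforce
      moreover have "\<forall>x\<in>set a \<union> set t. \<forall>v\<in>set c. x < v"
        using at tc(4) t by (metis UnE order.strict_trans)
      ultimately show ?thesis unfolding contained3 using ab(2) tc(2,3) by blast
    qed
    then show False using w(2) by simp
  qed
  with below avoid show ?thesis by blast
qed

section \<open>Red entries followed by blue entries\<close>

text \<open>Because of \<open>red\<close> and \<open>blue\<close>, the seam cuts the middle block
  \<open>d\<close> of a copy into non-empty parts, red \<open>e\<close> and blue \<open>f\<close>.
  As \<open>d\<close> is decreasing, \<open>e\<close> lies above \<open>f\<close>, and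
  \<open>below\<close> then places \<open>e\<close> before \<open>f\<close> in \<open>w\<close>
  too.\<close>

lemma concat_avoids_sum_decr:
  assumes perm: "is_perm \<alpha>" "is_perm \<gamma>" and "n > 0"
    and w: "distinct w" "\<not> contained (\<alpha> \<oplus> \<delta> n \<oplus> \<gamma>) w"
    and below: "\<forall>r\<in>R. \<forall>b\<in>set w - R. precedes w b r \<longrightarrow> r < b"
    and red: "\<not> contained (\<alpha> \<oplus> \<delta> n) (filter (\<lambda>x. x \<in> R) w)"
    and blue: "\<not> contained (\<delta> n \<oplus> \<gamma>) (filter (\<lambda>x. x \<notin> R) w)"
  shows "\<not> contained (\<alpha> \<oplus> \<delta> n \<oplus> \<gamma>) (filter (\<lambda>x. x \<in> R) w @ filter (\<lambda>x. x \<notin> R) w)"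
proof
  note sub_iff = subseq_iff_sorted_wrt[OF w(1)]
  note trans = precedes_trans[OF w(1)]
  note contained3 = contained_perm_sum3[OF perm(1) is_perm_decr_perm perm(2)]
  let ?r = "filter (\<lambda>x. x \<in> R) w" and ?b = "filter (\<lambda>x. x \<notin> R) w"
  assume "contained (\<alpha> \<oplus> \<delta> n \<oplus> \<gamma>) (?r @ ?b)"
  then obtain a d c where adc: "subseq (a @ d @ c) (?r @ ?b)" "order_iso a \<alpha>" "order_iso d (\<delta> n)"
      "order_iso c \<gamma>" "\<forall>x\<in>set a. \<forall>y\<in>set d. x < y" "\<forall>x\<in>set a \<union> set d. \<forall>y\<in>set c. x < y"
    unfolding contained3 by blast
  obtain p q where pq: "a @ d @ c = p @ q" "subseq p ?r" "subseq q ?b"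
    using adc(1) by (rule subseq_appendE)
  have no_red: "\<not> subseq (a @ d) ?r"
    using red adc(2,3,5) unfolding contained_perm_sum[OF perm(1) is_perm_decr_perm] by blast
  have no_blue: "\<not> subseq (d @ c) ?b"
    using blue adc(3,4,6) unfolding contained_perm_sum[OF is_perm_decr_perm perm(2)] by blast
  \<comment> \<open>A seam inside or right after \<open>a\<close> would leave \<open>d @ c\<close>
    entirely blue.\<close>
  have "\<not> length p \<le> length a"
  proof
    assume "length p \<le> length a"
    moreover have "q = drop (length p) (a @ d @ c)" using pq(1) by simp
    ultimately have "q = drop (length p) a @ (d @ c)" by simp
    then have "subseq (d @ c) q" by (simp add: subseq_drop_many)
    then show False using pq(3) no_blue subseq_order.order_trans by blast
  qed
  moreover have "p = take (length p) (a @ d @ c)" using pq(1) by simp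
  ultimately obtain e where e: "p = a @ e" by (metis nat_le_linear take_all take_append)
  then have eq: "d @ c = e @ q" using pq(1) by simp
  \<comment> \<open>A seam right after \<open>d\<close> or later would leave \<open>a @ d\<close>
    entirely red.\<close>
  have "\<not> length d \<le> length e"
  proof
    assume "length d \<le> length e"
    moreover have "e = take (length e) (d @ c)" using eq by simp
    ultimately have "e = d @ take (length e - length d) c" by simp
    then have "subseq (a @ d) p" using e by (metis append_assoc subseq_rev_drop_many subseq_order.order_refl)
    then show False using pq(2) no_red subseq_order.order_trans by blast
  qed
  moreover from this have "e = take (length e) d" using eq by (metis append_eq_append_conv_if nat_le_linear)
  ultimately obtain f where f: "d = e @ f" "f \<noteq> []"
    by (metis append_take_drop_id append_Nil2 order_refl)
  then have q: "q = f @ c" using eq by simp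
  have "e \<noteq> []" using e \<open>\<not> length p \<le> length a\<close> by auto
  have dec: "y < x" if "x \<in> set e" "y \<in> set f" for x y
    using order_iso_decr_perm[OF adc(3)] that f(1) by (auto simp: sorted_wrt_append)
  have pw: "subseq (a @ e) w" and qw: "subseq (f @ c) w"
    using pq(2,3) e q subseq_filter_left subseq_order.order_trans by blast+
  have ef: "precedes w x y" if "x \<in> set e" "y \<in> set f" for x y
  proof -
    have "x \<in> R" "x \<in> set w" "y \<in> set w - R"
      using set_mono_subseq[OF pq(2)] set_mono_subseq[OF pq(3)] that e q by auto
    then show ?thesis
      using below dec[OF that] precedes_total[of x w y] by fastforce
  qed
  have "precedes w x y" if "x \<in> set (a @ e)" "y \<in> set (f @ c)" for x y
  proof -
    \<comment> \<open>Both parts are non-empty, so every pair across the seam can be linked through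
      some \<open>v\<close> in \<open>e\<close> and \<open>z\<close> in \<open>f\<close>.\<close>
    have "\<exists>v\<in>set e. x = v \<or> precedes w x v"
    proof (cases "x \<in> set e")
      case False
      then have "precedes w x (hd e)"
        using pw that(1) \<open>e \<noteq> []\<close> unfolding sub_iff by (auto simp: sorted_wrt_append)
      then show ?thesis using \<open>e \<noteq> []\<close> hd_in_set by blast
    qed blast
    moreover have "\<exists>z\<in>set f. y = z \<or> precedes w z y"
    proof (cases "y \<in> set f")
      case False
      then have "precedes w (hd f) y"
        using qw that(2) \<open>f \<noteq> []\<close> unfolding sub_iff by (auto simp: sorted_wrt_append)
      then show ?thesis using \<open>f \<noteq> []\<close> hd_in_set by blast
    qed blast
    ultimately obtain v z where vz: "v \<in> set e" "z \<in> set f" "x = v \<or> precedes w x v"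
        "y = z \<or> precedes w z y" by blast
    then show ?thesis using ef[OF vz(1,2)] trans by blast
  qed
  then have "subseq (a @ d @ c) w"
    using pw qw unfolding sub_iff f(1) by (auto simp: sorted_wrt_append)
  then show False using w(2) adc(2-6) unfolding contained3 by blast
qed

section \<open>Closure of the classes under containment\<close>

lemma sorted_wrt_subseq:
  assumes "subseq xs ys" "sorted_wrt P ys"
  shows "sorted_wrt P xs"
  using assms
proof (induction rule: list_emb.induct)
  case (list_emb_Cons2 x y xs ys)
  then show ?case using set_mono_subseq by fastforce
qed auto

lemma contained_refl: "contained p p"
  unfolding contained_def by (rule exI[of _ p]) (simp add: order_iso_def)

lemma perm_class_Av: "perm_class (Av p)"
  unfolding perm_class_def Av_def
  using contained_trans[of p] by (auto simp: is_perm_iff)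

text \<open>Any list of distinct numbers is order-isomorphic to a permutation, and avoidance is
  invariant under order isomorphism, so it can be tested on the blocks themselves.\<close>

lemma vmerge_Av:
  "\<V> (Av p) (Av q) =
     {r. is_perm r \<and> (\<exists>s1 s2. r = s1 @ s2 \<and> \<not> contained p s1 \<and> \<not> contained q s2)}"
proof -
  have avoid: "(\<exists>a\<in>Av p. order_iso s a) \<longleftrightarrow> \<not> contained p s" if "distinct s" for s p
    using that contained_order_iso[OF that] ex_is_perm_order_iso[OF that] unfolding Av_def by blast
  have "r = s1 @ s2 \<and> (\<exists>a\<in>Av p. order_iso s1 a) \<and> (\<exists>b\<in>Av q. order_iso s2 b) \<longleftrightarrow>
      r = s1 @ s2 \<and> \<not> contained p s1 \<and> \<not> contained q s2" if "is_perm r" for r s1 s2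
  proof (cases "r = s1 @ s2")
    case True
    then have "distinct s1" "distinct s2" using that by (simp_all add: is_perm_iff)
    then show ?thesis by (simp add: avoid)
  qed simp
  then show ?thesis unfolding vmerge_def by (intro Collect_cong conj_cong refl) simp
qed

lemma perm_class_vmerge_Av: "perm_class (\<V> (Av p) (Av q))"
  unfolding perm_class_def
proof (intro conjI ballI allI impI)
  fix r assume r: "r \<in> \<V> (Av p) (Av q)"
  then show "is_perm r" by (simp add: vmerge_Av)
  fix r' assume r': "is_perm r' \<and> contained r' r"
  obtain s1 s2 where s: "r = s1 @ s2" "\<not> contained p s1" "\<not> contained q s2"
    using r by (auto simp: vmerge_Av)
  obtain t where t: "subseq t r" "order_iso r' t"
    using r' order_iso_sym by (auto simp: contained_def)
  obtain t1 t2 where t12: "t = t1 @ t2" "subseq t1 s1" "subseq t2 s2"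
    using t(1) unfolding s(1) by (rule subseq_appendE)
  \<comment> \<open>The list \<open>r'\<close> is cut where its copy \<open>t\<close> passes from
    \<open>s1\<close> to \<open>s2\<close>.\<close>
  let ?k = "length t1"
  have "distinct r'" using r' by (simp add: is_perm_iff)
  moreover have "order_iso (take ?k r') t1" "order_iso (drop ?k r') t2"
    using order_iso_take[OF t(2), of ?k] order_iso_drop[OF t(2), of ?k] t12(1) by auto
  ultimately have "contained p (take ?k r') = contained p t1" "contained q (drop ?k r') = contained q t2"
    using contained_order_iso distinct_take distinct_drop by blast+
  then have "\<not> contained p (take ?k r')" "\<not> contained q (drop ?k r')"
    using s t12 contained_subseq by blast+
  then show "r' \<in> \<V> (Av p) (Av q)"
    unfolding vmerge_Av using r' append_take_drop_id[of ?k r', symmetric] by blast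
qed

lemma perm_class_Int: "perm_class A \<Longrightarrow> perm_class B \<Longrightarrow> perm_class (A \<inter> B)"
  unfolding perm_class_def by blast

text \<open>Coding the split by a set \<open>A\<close> of values turns the two parts into filters,
  which are easy to restrict to subsequences. Conversely, \<open>A\<close> is the set of values of
  \<open>s1\<close>, disjoint from those of \<open>s2\<close>.\<close>

lemma horiz_class_iff:
  "p \<in> \<H> \<longleftrightarrow> is_perm p \<and> (\<exists>A. sorted_wrt (<) (filter (\<lambda>x. x \<in> A) p) \<and>
     sorted_wrt (<) (filter (\<lambda>x. x \<notin> A) p) \<and> (\<forall>x\<in>set p \<inter> A. \<forall>y\<in>set p - A. x < y))"
    (is "_ \<longleftrightarrow> _ \<and> (\<exists>A. ?Q A)")
proof (intro iffI conjI)
  assume p: "p \<in> \<H>"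
  then show "is_perm p" by (simp add: horiz_class_def)
  obtain s1 s2 where s: "p \<in> shuffles s1 s2" "sorted_wrt (<) s1" "sorted_wrt (<) s2"
      "\<forall>x\<in>set s1. \<forall>y\<in>set s2. x < y"
    using p by (auto simp: horiz_class_def)
  have disj: "set s1 \<inter> set s2 = {}" using s(4) by fastforce
  have "?Q (set s1)"
    using filter_shuffles_disjoint1[OF disj s(1)] set_shuffles[OF s(1)] s(2-4) by auto
  then show "\<exists>A. ?Q A" by blast
next
  assume "is_perm p \<and> (\<exists>A. ?Q A)"
  then obtain A where A: "is_perm p" "?Q A" by blast
  then show "p \<in> \<H>"
    unfolding horiz_class_def using partition_in_shuffles[of p "\<lambda>x. x \<in> A"]
    by (intro CollectI conjI exI[of _ "filter (\<lambda>x. x \<in> A) p"] exI[of _ "filter (\<lambda>x. x \<notin> A) p"]) auto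
qed

lemma perm_class_horiz: "perm_class \<H>"
  unfolding perm_class_def
proof (intro conjI ballI allI impI)
  fix q assume q: "q \<in> \<H>"
  then show "is_perm q" by (simp add: horiz_class_def)
  then have "distinct q" by (simp add: is_perm_iff)
  fix p assume p: "is_perm p \<and> contained p q"
  obtain A where A: "sorted_wrt (<) (filter (\<lambda>x. x \<in> A) q)" "sorted_wrt (<) (filter (\<lambda>x. x \<notin> A) q)"
      "\<forall>x\<in>set q \<inter> A. \<forall>y\<in>set q - A. x < y"
    using q unfolding horiz_class_iff by blast
  obtain s where s: "subseq s q" "order_iso s p" using p by (auto simp: contained_def)
  obtain f where f: "strict_mono_on (set s) f" "p = map f s"
    using order_iso_imp_map[OF distinct_subseq[OF s(1) \<open>distinct q\<close>] s(2)] by blast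
  have sub: "set s \<subseteq> set q" using s(1) by (rule set_mono_subseq)
  \<comment> \<open>The split of \<open>q\<close> is restricted to \<open>s\<close> and carried over
    to \<open>p\<close> by \<open>f\<close>.\<close>
  let ?A = "f ` (A \<inter> set s)"
  have inA: "f x \<in> ?A \<longleftrightarrow> x \<in> A" if "x \<in> set s" for x
    using that strict_mono_on_imp_inj_on[OF f(1)] by (auto simp: inj_on_def)
  have sorted: "sorted_wrt (<) (map f (filter P s))" if "sorted_wrt (<) (filter P q)" for P
    using sorted_wrt_subseq[OF subseq_filter[OF s(1)] that] unfolding sorted_wrt_map
    by (rule sorted_wrt_mono_rel[rotated]) (use f(1) in \<open>auto simp: strict_mono_on_def\<close>)
  have "filter (\<lambda>x. x \<in> ?A) p = map f (filter (\<lambda>x. x \<in> A) s)"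
    "filter (\<lambda>x. x \<notin> ?A) p = map f (filter (\<lambda>x. x \<notin> A) s)"
    using inA unfolding f(2) filter_map by (auto intro!: arg_cong[where f = "map f"] filter_cong)
  moreover have "\<forall>x\<in>set p \<inter> ?A. \<forall>y\<in>set p - ?A. x < y"
  proof (intro ballI)
    fix x y assume "x \<in> set p \<inter> ?A" "y \<in> set p - ?A"
    then obtain u v where uv: "u \<in> set s" "u \<in> A" "x = f u" "v \<in> set s" "v \<notin> A" "y = f v"
      unfolding f(2) by auto
    then have "u < v" using A(3) sub by auto
    then show "x < y" using f(1) uv by (auto simp: strict_mono_on_def)
  qed
  ultimately show "p \<in> \<H>"
    unfolding horiz_class_iff using p sorted[OF A(1)] sorted[OF A(2)] by metis
qed

section \<open>Undoing the separation by composition\<close>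

lemma map_in_shuffles: "zs \<in> shuffles xs ys \<Longrightarrow> map f zs \<in> shuffles (map f xs) (map f ys)"
  by (induction xs ys arbitrary: zs rule: shuffles.induct) auto

text \<open>The factor \<open>q\<close> is the inverse of the concatenation composed with
  \<open>w\<close>: it lists, in the order of \<open>w\<close>, the positions of the entries in the
  concatenation. These increase within each block, and those of the first block are smaller.\<close>

lemma unshuffle_comp_horiz:
  assumes "is_perm w"
  obtains q where "q \<in> \<H>" "length q = length w"
    "perm_comp (filter P w @ filter (\<lambda>x. \<not> P x) w) q = w"
proof
  let ?u = "filter P w" and ?v = "filter (\<lambda>x. \<not> P x) w"
  let ?n = "length w"
  define t where "t = ?u @ ?v"
  have w: "distinct w" "set w = {1..?n}"
    using assms unfolding is_perm_iff by blast+
  have "length t = ?n" by (simp add: t_def sum_length_filter_compl)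
  moreover have "distinct t" using w(1) by (auto simp: t_def)
  moreover have "set t = set w" by (auto simp: t_def)
  ultimately have t: "distinct t" "set t = {1..?n}" "length t = ?n" using w(2) by simp_all
  \<comment> \<open>The permutation \<open>t\<close> as a function on 1-based positions, matching
    the index shift in \<open>perm_comp\<close>.\<close>
  define val where "val i = t ! (i - 1)" for i
  have "inj_on val {1..?n}"
  proof (rule inj_onI)
    fix i j assume ij: "i \<in> {1..?n}" "j \<in> {1..?n}" "val i = val j"
    then have "i - 1 = j - 1"
      using nth_eq_iff_index_eq[OF t(1), of "i - 1" "j - 1"] t(3) by (auto simp: val_def)
    then show "i = j" using ij(1,2) by auto
  qed
  moreover have "val ` {1..?n} = {1..?n}"
  proof (rule card_subset_eq)
    show "val ` {1..?n} \<subseteq> {1..?n}"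
    proof (rule image_subsetI)
      fix i assume "i \<in> {1..?n}"
      then have "t ! (i - 1) \<in> set t" using t(3) by (intro nth_mem) auto
      then show "val i \<in> {1..?n}" unfolding val_def t(2) .
    qed
  qed (use calculation in \<open>auto simp: card_image\<close>)
  ultimately have bij: "bij_betw val {1..?n} {1..?n}" by (simp add: bij_betw_def)
  define pos where "pos = inv_into {1..?n} val"
  define q where "q = map pos w"
  have "is_perm q"
    using bij_betw_inv_into[OF bij] w by (simp add: q_def is_perm_iff distinct_map bij_betw_def pos_def)
  \<comment> \<open>Read along \<open>t\<close>, the positions are consecutive, which gives all the
    order conditions for membership in \<open>\<H>\<close> at once.\<close>
  moreover have "map pos t = [1..<Suc ?n]"
  proof (rule nth_equalityI)
    fix i assume "i < length (map pos t)"
    then have i: "i < ?n" using t(3) by simp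
    then have "pos (val (Suc i)) = Suc i"
      unfolding pos_def using bij by (intro inv_into_f_f) (auto simp: bij_betw_def)
    then show "map pos t ! i = [1..<Suc ?n] ! i"
      using i t(3) by (simp add: val_def del: upt_Suc)
  qed (simp add: t(3) del: upt_Suc)
  then have "sorted_wrt (<) (map pos ?u @ map pos ?v)"
    using sorted_wrt_upt[of 1 "Suc ?n"] by (simp only: t_def map_append)
  then have "sorted_wrt (<) (map pos ?u) \<and> sorted_wrt (<) (map pos ?v) \<and>
      (\<forall>x\<in>set (map pos ?u). \<forall>y\<in>set (map pos ?v). x < y)"
    unfolding sorted_wrt_append .
  moreover have "q \<in> shuffles (map pos ?u) (map pos ?v)"
    unfolding q_def by (intro map_in_shuffles partition_in_shuffles)
  ultimately show "q \<in> \<H>" unfolding horiz_class_def by blast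
  show "length q = ?n" by (simp add: q_def)
  have "perm_comp t q = map (\<lambda>x. val (pos x)) w"
    by (simp add: perm_comp_def q_def val_def)
  also have "\<dots> = w"
    unfolding pos_def using bij w(2)
    by (intro map_idI f_inv_into_f) (auto simp: bij_betw_def)
  finally show "perm_comp (?u @ ?v) q = w" unfolding t_def .
qed

section \<open>The inclusion, and properness of both factors\<close>

text \<open>Neither block is long enough for a whole copy, so a copy starts in \<open>u\<close> and
  ends in \<open>v\<close>, with its first entry above its last. But its first entry belongs to
  \<open>\<alpha>\<close> and its last to \<open>\<gamma>\<close>.\<close>

lemma avoids_skew_sum:
  assumes perm: "is_perm \<alpha>" "is_perm \<beta>" "is_perm \<gamma>" and "\<alpha> \<noteq> []" "\<gamma> \<noteq> []"
    and less: "\<forall>x\<in>set u. \<forall>y\<in>set v. y < x"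
    and len: "length u < length (\<alpha> \<oplus> \<beta> \<oplus> \<gamma>)" "length v < length (\<alpha> \<oplus> \<beta> \<oplus> \<gamma>)"
  shows "\<not> contained (\<alpha> \<oplus> \<beta> \<oplus> \<gamma>) (u @ v)"
proof
  assume "contained (\<alpha> \<oplus> \<beta> \<oplus> \<gamma>) (u @ v)"
  then obtain a b c where abc: "subseq (a @ b @ c) (u @ v)" "order_iso a \<alpha>" "order_iso b \<beta>"
      "order_iso c \<gamma>" "\<forall>x\<in>set a \<union> set b. \<forall>y\<in>set c. x < y"
    unfolding contained_perm_sum3[OF perm] by blast
  obtain x y where xy: "a @ b @ c = x @ y" "subseq x u" "subseq y v"
    using abc(1) by (rule subseq_appendE)
  have l: "length (a @ b @ c) = length (\<alpha> \<oplus> \<beta> \<oplus> \<gamma>)"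
    using abc(2-4) by (simp add: order_iso_def perm_sum_def)
  have ne: "a \<noteq> []" "c \<noteq> []"
    using abc(2,4) assms(4,5) by (auto simp: order_iso_def)
  have "x \<noteq> []" using l xy len(2) list_emb_length[OF xy(3)] by auto
  have "y \<noteq> []" using l xy len(1) list_emb_length[OF xy(2)] by auto
  have "hd x = hd a" "last y = last c"
    using arg_cong[OF xy(1), of hd] arg_cong[OF xy(1), of last] ne \<open>x \<noteq> []\<close> \<open>y \<noteq> []\<close> by simp_all
  then have "hd x < last y" using abc(5) ne by auto
  moreover have "last y < hd x"
    using less set_mono_subseq[OF xy(2)] set_mono_subseq[OF xy(3)] \<open>x \<noteq> []\<close> \<open>y \<noteq> []\<close>
    by (meson hd_in_set last_in_set subsetD)
  ultimately show False by simp
qed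

lemma Av_sum_decr_subset:
  assumes "is_perm \<alpha>" "is_perm \<gamma>" "n > 0"
  shows "Av (\<alpha> \<oplus> \<delta> n \<oplus> \<gamma>) \<subseteq>
    (\<V> (Av (\<alpha> \<oplus> \<delta> n)) (Av (\<delta> n \<oplus> \<gamma>)) \<inter> Av (\<alpha> \<oplus> \<delta> n \<oplus> \<gamma>)) \<circ>\<^sub>c \<H>"
proof
  fix w assume "w \<in> Av (\<alpha> \<oplus> \<delta> n \<oplus> \<gamma>)"
  then have w: "is_perm w" "distinct w" "\<not> contained (\<alpha> \<oplus> \<delta> n \<oplus> \<gamma>) w"
    by (simp_all add: Av_def is_perm_iff)
  have "\<delta> n \<noteq> []" using assms(3) by (simp add: decr_perm_def)
  from sum_avoider_colouring[OF assms(1) is_perm_decr_perm assms(2) this w(2,3)]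
  obtain R where R: "\<forall>r\<in>R. \<forall>b\<in>set w - R. precedes w b r \<longrightarrow> r < b"
    "\<not> contained (\<alpha> \<oplus> \<delta> n) (filter (\<lambda>x. x \<in> R) w)"
    "\<not> contained (\<delta> n \<oplus> \<gamma>) (filter (\<lambda>x. x \<notin> R) w)"
    by blast
  define t where "t = filter (\<lambda>x. x \<in> R) w @ filter (\<lambda>x. x \<notin> R) w"
  have "length t = length w" by (simp add: t_def sum_length_filter_compl)
  moreover have "set t = set w" by (auto simp: t_def)
  moreover have "distinct t" using w(2) by (auto simp: t_def)
  ultimately have t: "is_perm t" "length t = length w"
    using w(1) by (simp_all add: is_perm_iff)
  have "\<not> contained (\<alpha> \<oplus> \<delta> n \<oplus> \<gamma>) t"
    unfolding t_def using concat_avoids_sum_decr[OF assms w(2,3) R] .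
  then have "t \<in> \<V> (Av (\<alpha> \<oplus> \<delta> n)) (Av (\<delta> n \<oplus> \<gamma>)) \<inter> Av (\<alpha> \<oplus> \<delta> n \<oplus> \<gamma>)"
    unfolding vmerge_Av unfolding Av_def using t(1) R(2,3) t_def by blast
  moreover obtain q where "q \<in> \<H>" "length q = length w" "perm_comp t q = w"
    unfolding t_def using unshuffle_comp_horiz[OF w(1)] .
  ultimately show "w \<in> (\<V> (Av (\<alpha> \<oplus> \<delta> n)) (Av (\<delta> n \<oplus> \<gamma>)) \<inter> Av (\<alpha> \<oplus> \<delta> n \<oplus> \<gamma>)) \<circ>\<^sub>c \<H>"
    unfolding class_comp_def using t(2) by force
qed

text \<open>Two of the three entries fall into the same part, which is then not increasing.\<close>

lemma decr3_notin_horiz: "[3, 2, 1] \<notin> \<H>"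
proof
  assume "[3, 2, 1] \<in> \<H>"
  then obtain A :: "nat set" where A: "sorted_wrt (<) (filter (\<lambda>x. x \<in> A) [3, 2, 1])"
    "sorted_wrt (<) (filter (\<lambda>x. x \<notin> A) [3, 2, 1])"
    unfolding horiz_class_iff by blast
  then show False by (cases "3 \<in> A"; cases "2 \<in> A"; cases "1 \<in> A") simp_all
qed

lemma horiz_psubset_Av_sum:
  assumes perm: "is_perm \<alpha>" "is_perm \<beta>" "is_perm \<gamma>" and ne: "\<alpha> \<noteq> []" "\<beta> \<noteq> []" "\<gamma> \<noteq> []"
    and notin: "\<alpha> \<oplus> \<beta> \<oplus> \<gamma> \<notin> \<H>"
  shows "\<H> \<subset> Av (\<alpha> \<oplus> \<beta> \<oplus> \<gamma>)"
proof -
  have "is_perm (\<alpha> \<oplus> \<beta> \<oplus> \<gamma>)" using perm by (intro is_perm_perm_sum)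
  \<comment> \<open>If a member of \<open>\<H>\<close> contained the pattern, closure would put the
    pattern in \<open>\<H>\<close>.\<close>
  then have "\<H> \<subseteq> Av (\<alpha> \<oplus> \<beta> \<oplus> \<gamma>)"
    using perm_class_horiz notin unfolding perm_class_def Av_def by blast
  moreover have "[3, 2, 1] \<in> Av (\<alpha> \<oplus> \<beta> \<oplus> \<gamma>)"
  proof -
    have "length \<alpha> > 0" "length \<beta> > 0" "length \<gamma> > 0" using ne by simp_all
    moreover have "length (\<alpha> \<oplus> \<beta> \<oplus> \<gamma>) = length \<alpha> + length \<beta> + length \<gamma>"
      by (simp add: perm_sum_def)
    ultimately have "length (\<alpha> \<oplus> \<beta> \<oplus> \<gamma>) > 2" by linarith
    \<comment> \<open>The pattern has at least three entries, more than either block of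
      \<open>321\<close> cut after its first entry.\<close>
    then have "\<not> contained (\<alpha> \<oplus> \<beta> \<oplus> \<gamma>) ([3] @ [2, 1])"
      by (intro avoids_skew_sum perm ne(1,3)) simp_all
    moreover have "is_perm [3, 2, 1]" by (auto simp: is_perm_iff)
    ultimately show ?thesis by (simp add: Av_def)
  qed
  ultimately show ?thesis using decr3_notin_horiz by blast
qed

text \<open>However the skew sum \<open>u @ v\<close> is cut, the left piece contains all of
  \<open>u\<close>, a copy of \<open>\<alpha> \<oplus> \<beta>\<close>, or the right piece all of
  \<open>v\<close>, which is \<open>\<beta> \<oplus> \<gamma>\<close>.\<close>

lemma vmerge_Int_psubset_Av_sum:
  assumes perm: "is_perm \<alpha>" "is_perm \<beta>" "is_perm \<gamma>" and ne: "\<alpha> \<noteq> []" "\<gamma> \<noteq> []"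
  shows "\<V> (Av (\<alpha> \<oplus> \<beta>)) (Av (\<beta> \<oplus> \<gamma>)) \<inter> Av (\<alpha> \<oplus> \<beta> \<oplus> \<gamma>) \<subset> Av (\<alpha> \<oplus> \<beta> \<oplus> \<gamma>)"
proof -
  let ?m = "length (\<beta> \<oplus> \<gamma>)"
  define u where "u = map (\<lambda>x. x + ?m) (\<alpha> \<oplus> \<beta>)"
  define v where "v = \<beta> \<oplus> \<gamma>"
  have p: "distinct (\<alpha> \<oplus> \<beta>)" "set (\<alpha> \<oplus> \<beta>) = {1..length (\<alpha> \<oplus> \<beta>)}"
    "distinct v" "set v = {1..?m}"
    using is_perm_perm_sum[OF perm(1,2)] is_perm_perm_sum[OF perm(2,3)]
    unfolding is_perm_iff v_def by blast+
  have u: "set u = {1 + ?m..length (\<alpha> \<oplus> \<beta>) + ?m}"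
    unfolding u_def set_map p(2) by (rule image_add_atLeastAtMost')
  have "is_perm (u @ v)"
  proof -
    have "distinct u" using p(1) by (simp add: u_def distinct_map)
    moreover have "set u \<inter> set v = {}" "set u \<union> set v = {1..length (\<alpha> \<oplus> \<beta>) + ?m}"
      unfolding u p(4) by auto
    moreover have "length (u @ v) = length (\<alpha> \<oplus> \<beta>) + ?m" by (simp add: u_def v_def)
    ultimately show ?thesis unfolding is_perm_iff using p(3) by simp
  qed
  moreover have "\<not> contained (\<alpha> \<oplus> \<beta> \<oplus> \<gamma>) (u @ v)"
  proof (rule avoids_skew_sum[OF perm ne])
    show "\<forall>x\<in>set u. \<forall>y\<in>set v. y < x" unfolding u p(4) by auto
  qed (use ne in \<open>simp_all add: u_def v_def perm_sum_def\<close>)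
  ultimately have "u @ v \<in> Av (\<alpha> \<oplus> \<beta> \<oplus> \<gamma>)" by (simp add: Av_def)
  moreover have "u @ v \<notin> \<V> (Av (\<alpha> \<oplus> \<beta>)) (Av (\<beta> \<oplus> \<gamma>))"
  proof
    assume "u @ v \<in> \<V> (Av (\<alpha> \<oplus> \<beta>)) (Av (\<beta> \<oplus> \<gamma>))"
    then obtain s1 s2 where s: "u @ v = s1 @ s2" "\<not> contained (\<alpha> \<oplus> \<beta>) s1" "\<not> contained (\<beta> \<oplus> \<gamma>) s2"
      unfolding vmerge_Av by blast
    have "order_iso (\<alpha> \<oplus> \<beta>) u"
      unfolding u_def by (rule order_iso_map) (simp add: strict_mono_on_def)
    then have "contained (\<alpha> \<oplus> \<beta>) u"
      using contained_order_iso[OF p(1)] contained_refl by blast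
    then have "\<not> subseq u s1" using s(2) contained_subseq by blast
    moreover have "\<not> subseq v s2"
      using s(3) contained_refl contained_subseq unfolding v_def by blast
    moreover have "(\<exists>us. s2 = us @ v) \<or> (\<exists>us. s1 = u @ us)"
      using s(1) by (auto simp: append_eq_append_conv2)
    ultimately show False
      using subseq_drop_many[OF subseq_order.order_refl] subseq_rev_drop_many[OF subseq_order.order_refl]
      by blast
  qed
  ultimately show ?thesis by blast
qed

theorem theorem6p2:
  fixes \<alpha> \<gamma> :: "nat list" and n :: nat
  assumes "is_perm \<alpha>" and "\<alpha> \<noteq> []"
    and "is_perm \<gamma>" and "\<gamma> \<noteq> []"
    and "n > 0"
  shows "Av (\<alpha> \<oplus> \<delta> n \<oplus> \<gamma>) \<subseteq>
           (\<V> (Av (\<alpha> \<oplus> \<delta> n)) (Av (\<delta> n \<oplus> \<gamma>)) \<inter> Av (\<alpha> \<oplus> \<delta> n \<oplus> \<gamma>)) \<circ>\<^sub>c \<H>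
         \<and> (\<alpha> \<oplus> \<delta> n \<oplus> \<gamma> \<notin> \<H> \<longrightarrow> two_composable (Av (\<alpha> \<oplus> \<delta> n \<oplus> \<gamma>)))"
proof (intro conjI impI)
  show sub: "Av (\<alpha> \<oplus> \<delta> n \<oplus> \<gamma>) \<subseteq>
      (\<V> (Av (\<alpha> \<oplus> \<delta> n)) (Av (\<delta> n \<oplus> \<gamma>)) \<inter> Av (\<alpha> \<oplus> \<delta> n \<oplus> \<gamma>)) \<circ>\<^sub>c \<H>"
    using assms by (intro Av_sum_decr_subset)
  assume notin: "\<alpha> \<oplus> \<delta> n \<oplus> \<gamma> \<notin> \<H>"
  have "\<delta> n \<noteq> []" using assms(5) by (simp add: decr_perm_def)
  then have "\<H> \<subset> Av (\<alpha> \<oplus> \<delta> n \<oplus> \<gamma>)"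
    using assms notin is_perm_decr_perm by (intro horiz_psubset_Av_sum)
  moreover have "\<V> (Av (\<alpha> \<oplus> \<delta> n)) (Av (\<delta> n \<oplus> \<gamma>)) \<inter> Av (\<alpha> \<oplus> \<delta> n \<oplus> \<gamma>)
      \<subset> Av (\<alpha> \<oplus> \<delta> n \<oplus> \<gamma>)"
    using assms is_perm_decr_perm by (intro vmerge_Int_psubset_Av_sum)
  ultimately show "two_composable (Av (\<alpha> \<oplus> \<delta> n \<oplus> \<gamma>))"
    unfolding two_composable_def
    using sub perm_class_Av perm_class_horiz perm_class_Int[OF perm_class_vmerge_Av perm_class_Av]
    by blast
qed

end
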